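(* The set $\mathcal{U}$ is not the union of an infinite arithmetic progression $\{m_0h+a_0 : h=0,1,2,\dots\}$ of positive odd integers (with $m_0,a_0$ positive integers) and a set of asymptotic density zero.
   Context: $\mathcal{U}$ denotes the set of positive odd integers $n$ that cannot be written as $n=p+2^k$ with $p$ a prime and $k$ a positive integer. A set $A$ of positive integers has asymptotic density $\delta$ if $|A\cap[1,x]|/x\to\delta$ as $x\to\infty$. *)

theory Defs
  imports Complex_Main "HOL-Computational_Algebra.Primes"
begin

definition \<U> :: "nat set" where
  "\<U> = {n. n > 0 \<and> odd n \<and> \<not> (\<exists>p k. prime p \<and> k > 0 \<and> n = p + 2 ^ k)}"

definition has_asymptotic_density :: "nat set \<Rightarrow> real \<Rightarrow> bool" where
  "has_asymptotic_density A \<delta> \<longleftrightarrow>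
     ((\<lambda>x::real. real (card {n \<in> A. 1 \<le> real n \<and> real n \<le> x}) / x) \<longlongrightarrow> \<delta>) at_top"

end

theory Submission
  imports Defs "HOL-Number_Theory.Cong"
begin

text \<open>
  Erdos' covering congruences produce a residue \<open>c\<close> modulo
  \<open>M = 3 * 5 * 7 * 13 * 17 * 241\<close> such that every \<open>c - 2 ^ k\<close> is divisible by one of these six
  primes. Shifting the exponents of the covering shows that \<open>2 * c\<close> has the same property. Fixing
  the residue modulo \<open>256\<close> as \<open>1\<close> or \<open>-1\<close> excludes the case that \<open>n - 2 ^ k\<close> equals
  one of the six primes, so both residues yield infinite progressions modulo \<open>256 * M\<close> inside
  \<open>\<U>\<close>. If \<open>\<U>\<close> is a progression with difference \<open>m\<^sub>0\<close> up to density zero, then that progression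
  must swallow both, so \<open>m\<^sub>0\<close> divides \<open>256 * M\<close> as well as the difference of the two residues.
  As \<open>c\<close> is coprime to \<open>M\<close>, and \<open>1\<close> and \<open>-1\<close> differ by \<open>2\<close>, this forces \<open>m\<^sub>0\<close> to divide \<open>2\<close>.
  But then \<open>\<U>\<close> contains all large odd integers, including some \<open>p + 2\<close> with \<open>p\<close> prime.
\<close>

lemma not_density_zero_if_contains_progression:
  assumes "d > 0" and AP: "\<And>h. d * h + a \<in> W"
  shows "\<not> has_asymptotic_density W 0"
proof
  assume "has_asymptotic_density W 0"
  then have lim: "((\<lambda>x::real. real (card {n \<in> W. 1 \<le> real n \<and> real n \<le> x}) / x)
      \<longlongrightarrow> 0) at_top"
    by (simp add: has_asymptotic_density_def)
  \<comment> \<open>\<open>x = d * N + a\<close> is at most \<open>N * (d + a)\<close>, and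
    \<open>N\<close> terms lie in [1, x].\<close>
  define \<epsilon> where "\<epsilon> = 1 / real (d + a)"
  have "\<epsilon> > 0" using \<open>d > 0\<close> by (simp add: \<epsilon>_def)
  then have "\<forall>\<^sub>F x in at_top. real (card {n \<in> W. 1 \<le> real n \<and> real n \<le> x}) / x < \<epsilon>"
    using order_tendstoD(2)[OF lim] by blast
  then obtain X where
    X: "\<And>x. x \<ge> X \<Longrightarrow> real (card {n \<in> W. 1 \<le> real n \<and> real n \<le> x}) / x < \<epsilon>"
    by (auto simp: eventually_at_top_linorder)
  define N where "N = Suc (nat \<lceil>X\<rceil>)"
  define x where "x = d * N + a"
  have "N \<ge> 1" "real N \<ge> X" unfolding N_def by linarith+
  have "N \<le> x" using \<open>d > 0\<close> by (simp add: x_def trans_le_add1)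
  then have "real x \<ge> X" using \<open>real N \<ge> X\<close> by linarith
  let ?S = "{n \<in> W. 1 \<le> real n \<and> real n \<le> real x}"
  have "finite ?S" by (rule finite_subset[of _ "{..x}"]) auto
  moreover have "(\<lambda>h. d * h + a) ` {1..N} \<subseteq> ?S"
    using AP \<open>d > 0\<close> by (auto simp: x_def Suc_le_eq simp flip: of_nat_mult of_nat_add)
  ultimately have "card ((\<lambda>h. d * h + a) ` {1..N}) \<le> card ?S" by (rule card_mono)
  moreover have "card ((\<lambda>h. d * h + a) ` {1..N}) = N"
    using \<open>d > 0\<close> by (subst card_image) (auto simp: inj_on_def)
  ultimately have "N \<le> card ?S" by simp
  have "x \<le> N * (d + a)" using \<open>N \<ge> 1\<close> by (simp add: x_def algebra_simps)
  also have "\<dots> \<le> card ?S * (d + a)" using \<open>N \<le> card ?S\<close> by (rule mult_le_mono1)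
  finally have "real x \<le> real (card ?S) * real (d + a)" by (metis of_nat_le_iff of_nat_mult)
  moreover have "x > 0" using \<open>N \<le> x\<close> \<open>N \<ge> 1\<close> by simp
  ultimately have "\<epsilon> \<le> real (card ?S) / real x"
    using \<open>d > 0\<close> by (simp add: \<epsilon>_def field_simps)
  then show False using X[OF \<open>real x \<ge> X\<close>] by simp
qed

text \<open>If one term missed the residue, so would every \<open>m\<^sub>0\<close>-th term after
  it, putting a progression into \<open>W\<close>.\<close>

lemma progression_cong_if_subset_up_to_density_zero:
  fixes m a :: nat
  assumes "m > 0" "m\<^sub>0 > 0" and W: "has_asymptotic_density W 0"
    and sub: "\<And>h. m * h + a \<in> {m\<^sub>0 * h + a\<^sub>0 |h. True} \<union> W"
  shows "[m * t + a = a\<^sub>0] (mod m\<^sub>0)"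
proof (rule ccontr)
  assume ncong: "\<not> [m * t + a = a\<^sub>0] (mod m\<^sub>0)"
  have "m * m\<^sub>0 * h + (m * t + a) \<in> W" for h
  proof -
    have eq: "m * m\<^sub>0 * h + (m * t + a) = m * (m\<^sub>0 * h + t) + a" by (simp add: algebra_simps)
    have "[m * m\<^sub>0 * h + (m * t + a) = m * t + a] (mod m\<^sub>0)"
      by (simp add: cong_def mult.assoc mult.left_commute[of m])
    then have "m * m\<^sub>0 * h + (m * t + a) \<notin> {m\<^sub>0 * h + a\<^sub>0 |h. True}"
      using ncong by (auto simp: cong_def)
    then show ?thesis using sub[of "m\<^sub>0 * h + t"] unfolding eq by blast
  qed
  then show False
    using not_density_zero_if_contains_progression[of "m * m\<^sub>0"] assms by auto
qed

definition covering_primes :: "nat set" where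
  "covering_primes = {3, 5, 7, 13, 17, 241}"

lemma prime_covering_primes: "q \<in> covering_primes \<Longrightarrow> prime q"
  unfolding covering_primes_def by auto

text \<open>24 is the lcm of the orders 2, 4, 3, 12, 8, 24 of 2 modulo the six primes.\<close>

lemma two_power_mod_covering_prime:
  assumes "q \<in> covering_primes"
  shows "(2::nat) ^ k mod q = 2 ^ (k mod 24) mod q"
proof -
  have "(2 ^ 24) mod q = 1" using assms by (auto simp: covering_primes_def)
  then have "((2 ^ 24) ^ (k div 24)) mod q = 1 ^ (k div 24) mod q"
    by (metis power_mod)
  then have "[(2 ^ 24) ^ (k div 24) * 2 ^ (k mod 24) = 1 * 2 ^ (k mod 24)] (mod q)"
    by (intro cong_mult cong_refl) (simp add: cong_def)
  moreover have "(2::nat) ^ k = (2 ^ 24) ^ (k div 24) * 2 ^ (k mod 24)"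
    by (simp only: flip: power_mult power_add) simp
  ultimately show ?thesis by (simp add: cong_def)
qed

lemma covered_imp_mem_\<U>:
  assumes cover: "\<And>k. k < 24 \<Longrightarrow> \<exists>q\<in>covering_primes. n mod q = 2 ^ k mod q"
    and "odd n" and "n > 369" and res: "n mod 256 \<notin> covering_primes"
  shows "n \<in> \<U>"
proof (rule ccontr)
  assume "n \<notin> \<U>"
  then obtain p k where "prime p" and n: "n = p + 2 ^ k"
    unfolding \<U>_def using \<open>odd n\<close> \<open>n > 369\<close> by auto
  obtain q where q: "q \<in> covering_primes" "n mod q = 2 ^ (k mod 24) mod q"
    using cover[of "k mod 24"] by auto
  then have "n mod q = 2 ^ k mod q" using two_power_mod_covering_prime by metis
  then have "q dvd p" using mod_eq_dvd_iff_nat[of "2 ^ k" n q] n by simp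
  then have "p = q"
    using \<open>prime p\<close> prime_covering_primes[OF q(1)] primes_dvd_imp_eq by blast
  have small: "q \<le> 241" using q(1) by (auto simp: covering_primes_def)
  show False
  \<comment> \<open>The bound 369 is 241 + 2^7; from k = 8 on, \<open>n mod 256\<close> is q
    itself.\<close>
  proof (cases "k < 8")
    case True
    then have "(2::nat) ^ k \<le> 2 ^ 7" by (intro power_increasing) auto
    then show False using \<open>n > 369\<close> n \<open>p = q\<close> small by simp
  next
    case False
    then have "(256::nat) dvd 2 ^ k" using le_imp_power_dvd[of 8 k "2::nat"] by simp
    then obtain c where "(2::nat) ^ k = 256 * c" by (rule dvdE)
    then have "n mod 256 = q" using n \<open>p = q\<close> small by simp
    then show False using res q(1) by simp
  qed
qed

text \<open>Lets \<open>simp\<close> check the 24 exponents one by one.\<close>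

lemma all_less_iff_list_all_upt: "(\<forall>k<n. P k) \<longleftrightarrow> list_all P [0..<n]"
  by (auto simp: list_all_iff)

lemma progression_subset_\<U>:
  assumes cover: "\<forall>k<24. \<exists>q\<in>covering_primes. a mod q = 2 ^ k mod q"
    and a: "odd a" "a > 369" "a mod 256 \<notin> covering_primes"
  shows "1431655680 * h + a \<in> \<U>"
proof (rule covered_imp_mem_\<U>)
  fix k :: nat assume "k < 24"
  then obtain q where q: "q \<in> covering_primes" "a mod q = 2 ^ k mod q" using cover by blast
  have "q dvd 1431655680" using q(1) unfolding covering_primes_def by auto
  then obtain c where "(1431655680::nat) = q * c" by (rule dvdE)
  then have "(1431655680 * h + a) mod q = a mod q" by (simp only: mult.assoc mod_mult_self4)
  then show "\<exists>q\<in>covering_primes. (1431655680 * h + a) mod q = 2 ^ k mod q" using q by auto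
next
  have "1431655680 * h + a = 256 * (5592405 * h) + a" by simp
  then have "(1431655680 * h + a) mod 256 = a mod 256" by (simp only: mod_mult_self4)
  then show "(1431655680 * h + a) mod 256 \<notin> covering_primes" using a by simp
qed (use a in auto)

text \<open>
  The covering is \<open>0 (mod 2)\<close>, \<open>0 (mod 3)\<close>, \<open>1 (mod 4)\<close>, \<open>3 (mod 8)\<close>, \<open>7 (mod 12)\<close>,
  \<open>23 (mod 24)\<close>, attached to \<open>3, 7, 5, 17, 13, 241\<close>; it gives \<open>c = 2036812\<close> modulo
  \<open>M = 5592405\<close>. The offset \<open>1260327937\<close> is \<open>c\<close> modulo \<open>M\<close> and \<open>1\<close> modulo \<open>256\<close>, the offset
  \<open>1139331839\<close> is \<open>2 * c\<close> modulo \<open>M\<close> and \<open>-1\<close> modulo \<open>256\<close>.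
\<close>

lemma progression_subset_\<U>_1: "1431655680 * h + 1260327937 \<in> \<U>"
  by (rule progression_subset_\<U>)
     (simp_all add: all_less_iff_list_all_upt covering_primes_def upt_rec)

lemma progression_subset_\<U>_2: "1431655680 * h + 1139331839 \<in> \<U>"
  by (rule progression_subset_\<U>)
     (simp_all add: all_less_iff_list_all_upt covering_primes_def upt_rec)

theorem theorem6:
  shows "\<not> (\<exists>(m\<^sub>0::nat) (a\<^sub>0::nat) (W::nat set).
           m\<^sub>0 > 0 \<and> a\<^sub>0 > 0 \<and> (\<forall>h::nat. odd (m\<^sub>0 * h + a\<^sub>0)) \<and>
           W \<subseteq> {0<..} \<and> has_asymptotic_density W 0 \<and>
           \<U> = {m\<^sub>0 * h + a\<^sub>0 |h::nat. True} \<union> W)"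
proof
  assume "\<exists>(m\<^sub>0::nat) (a\<^sub>0::nat) (W::nat set).
           m\<^sub>0 > 0 \<and> a\<^sub>0 > 0 \<and> (\<forall>h::nat. odd (m\<^sub>0 * h + a\<^sub>0)) \<and>
           W \<subseteq> {0<..} \<and> has_asymptotic_density W 0 \<and>
           \<U> = {m\<^sub>0 * h + a\<^sub>0 |h::nat. True} \<union> W"
  then obtain m\<^sub>0 a\<^sub>0 W where "m\<^sub>0 > 0" and odd_AP: "\<And>h. odd (m\<^sub>0 * h + a\<^sub>0)"
    and W: "has_asymptotic_density W 0" and \<U>: "\<U> = {m\<^sub>0 * h + a\<^sub>0 |h. True} \<union> W"
    by blast
  let ?m = "1431655680::nat" and ?a = "1260327937::nat" and ?b = "1139331839::nat"
  have a: "[?m * t + ?a = a\<^sub>0] (mod m\<^sub>0)" for t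
    using progression_subset_\<U>_1 \<open>m\<^sub>0 > 0\<close> W unfolding \<U>
    by (intro progression_cong_if_subset_up_to_density_zero) auto
  have b: "[?m * t + ?b = a\<^sub>0] (mod m\<^sub>0)" for t
    using progression_subset_\<U>_2 \<open>m\<^sub>0 > 0\<close> W unfolding \<U>
    by (intro progression_cong_if_subset_up_to_density_zero) auto
  have "[?m * 1 + ?a = ?m * 0 + ?a] (mod m\<^sub>0)" using a cong_sym cong_trans by blast
  then have "m\<^sub>0 dvd ?m * 1 + ?a - (?m * 0 + ?a)" by (subst (asm) cong_altdef_nat) auto
  moreover have "[?m * 0 + ?a = ?m * 0 + ?b] (mod m\<^sub>0)" using a b cong_sym cong_trans by blast
  then have "m\<^sub>0 dvd (?m * 0 + ?a) - (?m * 0 + ?b)" by (subst (asm) cong_altdef_nat) auto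
  \<comment> \<open>120996098 is \<open>?a - ?b\<close>.\<close>
  ultimately have "m\<^sub>0 dvd gcd 1431655680 120996098" by simp
  also have "gcd 1431655680 120996098 = (2::nat)" by (simp add: gcd_non_0_nat)
  finally have "m\<^sub>0 dvd 2" .
  obtain p where p: "prime p" "p > a\<^sub>0 + 2" using bigger_prime by blast
  then have "odd p" using prime_odd_nat by simp
  moreover have "odd a\<^sub>0" using odd_AP[of 0] by simp
  ultimately have "2 dvd p + 2 - a\<^sub>0" using p by simp
  then have "m\<^sub>0 dvd p + 2 - a\<^sub>0" using \<open>m\<^sub>0 dvd 2\<close> dvd_trans by blast
  then obtain h where "p + 2 - a\<^sub>0 = m\<^sub>0 * h" by blast
  then have "p + 2 = m\<^sub>0 * h + a\<^sub>0" using p by simp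
  then have "p + 2 ^ 1 \<in> \<U>" unfolding \<U> by auto
  then show False using p(1) unfolding \<U>_def by blast
qed

end
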